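(* Let $a,z$ be indeterminates and work over $\mathbb{Q}(a,z)$. Let $g(x)\in\mathbb{Q}(a,z)[[x]]$ with $g(0)=0$ be defined by $$g(x)=(a+1)x\big(1+g(x)\big)^{\frac{2a}{a+1}},$$ and let $f(x)=\big(1+g(x)\big)^{\frac{za}{a+1}}$. Define $$\rho(n)=\frac{\prod_{i=1}^{n-1}\big((2n-z)a-(a+1)i\big)}{n\prod_{i=1}^{n-2}\big((2n-2+z)a-(a+1)i\big)}.$$ Then $1+\sum_{n\ge1}\Big(\sum_{F\in PF(n)}\prod_{h\in\mathcal{H}(F)}\rho(h)\Big)x^n=f(x)$, i.e. for every $n\ge1$, $$\sum_{F\in PF(n)}\prod_{h\in\mathcal{H}(F)}\frac{\prod_{i=1}^{h-1}\big((2h-z)a-(a+1)i\big)}{h\prod_{i=1}^{h-2}\big((2h-2+z)a-(a+1)i\big)}=\frac{za}{n!}\prod_{i=1}^{n-1}\big((2n+z)a-(a+1)i\big).$$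
   Context: A plane tree is a rooted unlabeled tree in which the (nonempty) subtrees of each vertex are arranged in linear order; a plane forest is a linearly ordered sequence of plane trees; $PF(n)$ is the set of plane forests with $n$ vertices. For a vertex $u$ of a forest $F$, the hook length $h_u$ is the number of descendants of $u$ (counting $u$ itself), and $\mathcal{H}(F)$ is the multiset of hook lengths of all vertices; the product is over all vertices. For a power series $g$ with $g(0)=0$, $(1+g)^r=\sum_{j\ge0}\binom{r}{j}g^j$. Product convention: $\prod_{i=1}^{m}c_i$ is the ordinary product for $m\ge1$, equals $1$ for $m=0$, and for $m=-1$ equals $1/c_0$ where $c_0$ is the factor evaluated at $i=0$ (so for $h=1$, $\prod_{i=1}^{-1}((2h-2+z)a-(a+1)i)=1/(za)$). *)

theory Defs
  imports "HOL-Computational_Algebra.Computational_Algebra"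
begin

subsection \<open>Plane forests and hook lengths\<close>

datatype plane_tree = Node (children: "plane_tree list")

type_synonym plane_forest = "plane_tree list"

primrec tree_vertices :: "plane_tree \<Rightarrow> nat" where
  "tree_vertices (Node ts) = Suc (sum_list (map tree_vertices ts))"

definition forest_vertices :: "plane_forest \<Rightarrow> nat" where
  "forest_vertices F = sum_list (map tree_vertices F)"

definition PF :: "nat \<Rightarrow> plane_forest set" where
  "PF n = {F. forest_vertices F = n}"

text \<open>
  The descendants of a vertex, itself included, are the vertices of the tree rooted at it,
  so the hook length of the root of a tree is the number of vertices of that tree.
\<close>

primrec tree_hooks :: "plane_tree \<Rightarrow> nat multiset" where
  "tree_hooks (Node ts) =
     add_mset (tree_vertices (Node ts)) (sum_list (map tree_hooks ts))"

definition hooks :: "plane_forest \<Rightarrow> nat multiset" where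
  "hooks F = sum_list (map tree_hooks F)"

text \<open>In particular, sums over \<^term>\<open>PF n\<close> are genuine finite sums.\<close>

lemma finite_PF: "finite (PF n)"
proof (induction n rule: less_induct)
  case (less n)
  let ?B = "\<Union>k<n. (\<lambda>(ts, F). Node ts # F) ` (PF k \<times> PF (n - 1 - k))"
  have "PF n \<subseteq> insert [] ?B"
  proof
    fix F assume F: "F \<in> PF n"
    show "F \<in> insert [] ?B"
    proof (cases F)
      case (Cons t G)
      obtain ts where t: "t = Node ts" by (cases t)
      define k where "k = forest_vertices ts"
      have n: "n = Suc (k + forest_vertices G)"
        using F by (simp add: PF_def forest_vertices_def Cons t k_def)
      have "ts \<in> PF k" "G \<in> PF (n - 1 - k)" "k < n"
        using n by (simp_all add: PF_def k_def)
      then show ?thesis unfolding Cons t by force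
    qed simp
  qed
  moreover have "finite (insert [] ?B)"
    using less.IH by auto
  ultimately show ?case by (rule finite_subset)
qed

subsection \<open>The coefficient field and the power series\<close>

type_synonym ratfun = "rat poly poly fract"

text \<open>
  The field of rational functions over the rationals in two indeterminates, as the fraction
  field of \<open>\<rat>[a][z]\<close>.
\<close>

definition indet_a :: ratfun where
  "indet_a = to_fract [:[:0, 1:]:]"

definition indet_z :: ratfun where
  "indet_z = to_fract [:0, 1:]"

text \<open>
  The power \<open>(1 + g)\<^sup>r\<close> as the binomial series \<open>\<Sum>j. (r gchoose j) g\<^sup>j\<close>; meaningful only for
  a series \<open>g\<close> with zero constant term.
\<close>

definition one_plus_powr :: "'k::field_char_0 fps \<Rightarrow> 'k \<Rightarrow> 'k fps" where
  "one_plus_powr g r = fps_binomial r oo g"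

text \<open>The functional equation for the series \<open>g\<close> has exactly one solution.\<close>

lemma functional_equation_ex1:
  fixes c r :: "'k::field_char_0"
  assumes c: "c \<noteq> 0"
  shows "\<exists>!g. g $ 0 = 0 \<and> g = fps_const c * fps_X * one_plus_powr g r"
    (is "\<exists>!g. ?P g")
proof -
  define B where "B = fps_const c * fps_binomial r"
  define h where "h = fps_X * inverse B"
  have B0: "B $ 0 \<noteq> 0" using c by (simp add: B_def)
  have h: "h $ 0 = 0" "h $ 1 \<noteq> 0" using B0 by (simp_all add: h_def)
  have iff: "?P g \<longleftrightarrow> g $ 0 = 0 \<and> h oo g = fps_X" for g
  proof (cases "g $ 0 = 0")
    case True
    have Bg: "(B oo g) $ 0 \<noteq> 0" using B0 by simp
    have "h oo g = g * inverse (B oo g)"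
      using True B0 by (simp add: h_def fps_compose_mult_distrib fps_inverse_compose)
    moreover have "g * inverse (B oo g) = fps_X \<longleftrightarrow> g = fps_X * (B oo g)"
    proof
      assume "g * inverse (B oo g) = fps_X"
      then have "g * inverse (B oo g) * (B oo g) = fps_X * (B oo g)" by simp
      then show "g = fps_X * (B oo g)"
        using inverse_mult_eq_1[OF Bg] by (simp add: mult.assoc)
    next
      assume "g = fps_X * (B oo g)"
      then have "g * inverse (B oo g) = fps_X * (B oo g) * inverse (B oo g)" by simp
      then show "g * inverse (B oo g) = fps_X"
        using inverse_mult_eq_1'[OF Bg] by (simp add: mult.assoc)
    qed
    moreover have "B oo g = fps_const c * one_plus_powr g r"
      using True by (simp add: B_def one_plus_powr_def fps_compose_mult_distrib)
    ultimately show ?thesis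
      using True by (simp add: mult.left_commute mult.assoc)
  qed simp
  have inv: "h oo fps_inv h = fps_X" "fps_inv h $ 0 = 0"
    using fps_inv_right[OF h] by (simp_all add: fps_inv_def)
  show ?thesis
  proof
    show "?P (fps_inv h)" using inv iff by blast
  next
    fix g assume "?P g"
    then have g: "g $ 0 = 0" "h oo g = fps_X" using iff by blast+
    have "g = fps_X oo g" using g by simp
    also have "\<dots> = (fps_inv h oo h) oo g" using fps_inv[OF h] by simp
    also have "\<dots> = fps_inv h oo (h oo g)"
      by (rule fps_compose_assoc[OF g(1) h(1), symmetric])
    finally show "g = fps_inv h" using g by simp
  qed
qed

lemma indet_a_plus_1_nonzero: "indet_a + 1 \<noteq> 0"
proof -
  have "indet_a + 1 = to_fract ([:[:0, 1:]:] + 1)"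
    unfolding indet_a_def by (simp only: to_fract_add to_fract_1)
  also have "\<dots> \<noteq> 0"
    by (simp add: one_pCons)
  finally show ?thesis .
qed

subsection \<open>The weight\<close>

text \<open>
  The product of the \<open>c i\<close> for \<open>i\<close> from 1 to \<open>m\<close>, extended to \<open>m = -1\<close> so that
  \<open>prod_upto c m = c m * prod_upto c (m - 1)\<close> still holds (for \<open>c 0 \<noteq> 0\<close>) at \<open>m = 0\<close>.
  It is used only for \<open>m \<ge> -1\<close>.
\<close>

definition prod_upto :: "(int \<Rightarrow> 'k::field) \<Rightarrow> int \<Rightarrow> 'k" where
  "prod_upto c m = (if m = -1 then 1 / c 0 else \<Prod>i = 1..m. c i)"

definition rho :: "'k::field \<Rightarrow> 'k \<Rightarrow> nat \<Rightarrow> 'k" where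
  "rho a z n =
     prod_upto (\<lambda>i. (2 * of_nat n - z) * a - (a + 1) * of_int i) (int n - 1) /
     (of_nat n *
      prod_upto (\<lambda>i. (2 * of_nat n - 2 + z) * a - (a + 1) * of_int i) (int n - 2))"

end

theory Submission
  imports Defs
begin

text \<open>
  Let \<open>s\<^sub>n\<close> be the weighted hook sum over \<open>PF n\<close>. Splitting a nonempty forest into its first tree
  and the rest gives \<open>s\<^sub>n\<^sub>+\<^sub>1 = \<Sum>k\<le>n. \<rho>(k + 1) s\<^sub>k s\<^sub>n\<^sub>-\<^sub>k\<close>, so it suffices that
  \<open>[x\<^sup>m\<^sup>+\<^sup>1] (1 - 1/f) = \<rho>(m + 1) [x\<^sup>m] f\<close> for all \<open>m\<close>. Since \<open>1/f\<close> arises from \<open>f\<close> by replacing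
  \<open>z\<close> with \<open>-z\<close>, Lagrange inversion gives the coefficients of both series, and \<open>\<rho>\<close> is exactly their
  quotient.
\<close>

section \<open>Lagrange inversion for formal power series\<close>

lemma fps_compose_mult_nth:
  fixes F G h :: "'k::field fps"
  assumes h0: "h $ 0 = 0"
  shows "((F oo h) * G) $ n = (\<Sum>i=0..n. F $ i * (h ^ i * G) $ n)"
proof -
  \<comment> \<open>\<open>h ^ i\<close> has no terms below degree \<open>i\<close>, so every inner
    sum may run up to the common bound \<open>n\<close>; the two sums can then be swapped.\<close>
  have *: "(F oo h) $ j = (\<Sum>i=0..n. F $ i * (h ^ i) $ j)" if "j \<le> n" for j
    unfolding fps_compose_nth
    by (rule sum.mono_neutral_left) (use that startsby_zero_power_prefix[OF h0] in auto)
  have "((F oo h) * G) $ n = (\<Sum>j=0..n. \<Sum>i=0..n. F $ i * (h ^ i) $ j * G $ (n - j))"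
    by (simp add: fps_mult_nth * sum_distrib_right)
  also have "\<dots> = (\<Sum>i=0..n. \<Sum>j=0..n. F $ i * (h ^ i) $ j * G $ (n - j))"
    by (rule sum.swap)
  finally show ?thesis
    by (simp add: fps_mult_nth sum_distrib_left mult.assoc)
qed

text \<open>By associativity, a right inverse of \<open>h\<close> equals its left inverse
  \<open>fps_inv h\<close>.\<close>

lemma fps_compositional_inverse_unique:
  fixes g h :: "'k::field fps"
  assumes g0: "g $ 0 = 0" and h: "h $ 0 = 0" "h $ 1 \<noteq> 0" and hg: "h oo g = fps_X"
  shows "g oo h = fps_X"
proof -
  have "g = (fps_inv h oo h) oo g" using fps_inv[OF h] g0 by simp
  also have "\<dots> = fps_inv h oo (h oo g)"
    by (rule fps_compose_assoc[OF g0 h(1), symmetric])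
  finally have "g = fps_inv h" using hg by simp
  then show ?thesis using fps_inv[OF h] by simp
qed

lemma Lagrange_coefficient:
  fixes \<phi> h :: "'k::field_char_0 fps"
  assumes h0: "h $ 0 = 0" and h: "h * \<phi> = fps_X" and le: "i \<le> n"
  shows "(h ^ i * (fps_deriv h * \<phi> ^ Suc n)) $ n = (if i = n then 1 else 0)"
  \<comment> \<open>The left-hand side is the residue of \<open>h\<^sup>i\<^sup>-\<^sup>n\<^sup>-\<^sup>1 h'\<close>, stated without Laurent series.\<close>
proof -
  have "fps_deriv (h * \<phi>) = 1" by (simp add: h)
  then have h': "fps_deriv h * \<phi> = 1 - h * fps_deriv \<phi>"
    by (simp add: algebra_simps)
  show ?thesis
  proof (cases "i = n")
    case True
    have "h ^ n * (fps_deriv h * \<phi> ^ Suc n) = (h * \<phi>) ^ n * (fps_deriv h * \<phi>)"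
      by (simp add: power_mult_distrib mult_ac)
    then show ?thesis by (simp add: True h h0 h' fps_X_power_mult_nth)
  next
    case False
    then obtain j where n: "n = Suc (i + j)"
      using le less_imp_Suc_add[of i n] by auto
    have "h ^ i * (fps_deriv h * \<phi> ^ Suc n) =
        (h * \<phi>) ^ i * ((fps_deriv h * \<phi>) * \<phi> * \<phi> ^ j)"
      by (simp add: n power_add power_mult_distrib mult_ac)
    also have "(fps_deriv h * \<phi>) * \<phi> * \<phi> ^ j = \<phi> ^ Suc j - (h * \<phi>) * (fps_deriv \<phi> * \<phi> ^ j)"
      by (simp only: h') (simp add: algebra_simps)
    also have "(h * \<phi>) ^ i * (\<phi> ^ Suc j - (h * \<phi>) * (fps_deriv \<phi> * \<phi> ^ j)) =
        fps_X ^ i * (\<phi> ^ Suc j - fps_X * (fps_deriv \<phi> * \<phi> ^ j))"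
      by (simp only: h)
    finally have "(h ^ i * (fps_deriv h * \<phi> ^ Suc n)) $ n =
        (\<phi> ^ Suc j) $ Suc j - (fps_deriv \<phi> * \<phi> ^ j) $ j"
      by (simp add: n fps_X_power_mult_nth)
    \<comment> \<open>Up to the factor \<open>Suc j\<close>, the second series is the derivative of
      \<open>\<phi> ^ Suc j\<close>, so the two coefficients cancel: an exact derivative has no
      residue.\<close>
    moreover have "fps_deriv (\<phi> ^ Suc j) $ j = of_nat (Suc j) * (fps_deriv \<phi> * \<phi> ^ j) $ j"
      by (subst fps_deriv_power) (simp add: mult.assoc del: power_Suc of_nat_Suc flip: fps_of_nat)
    then have "(fps_deriv \<phi> * \<phi> ^ j) $ j = (\<phi> ^ Suc j) $ Suc j"
      by (simp del: power_Suc of_nat_Suc)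
    ultimately show ?thesis using False by simp
  qed
qed

text \<open>The inverse of \<open>g\<close> is \<open>h = x / \<phi>\<close>. For
  \<open>P = H oo g\<close> the chain rule gives \<open>H' = (P' oo h) h'\<close>, and in the
  expansion of \<open>P' oo h\<close> in powers of \<open>h\<close> only the term
  \<open>i = n\<close> survives, by \<open>Lagrange_coefficient\<close>.\<close>

theorem Lagrange_inversion:
  fixes \<phi> g H :: "'k::field_char_0 fps"
  assumes \<phi>0: "\<phi> $ 0 \<noteq> 0" and g0: "g $ 0 = 0" and g: "g = fps_X * (\<phi> oo g)"
  shows "of_nat (Suc n) * (H oo g) $ Suc n = (fps_deriv H * \<phi> ^ Suc n) $ n"
proof -
  define h where "h = fps_X * inverse \<phi>"
  have h: "h $ 0 = 0" "h $ 1 \<noteq> 0" using \<phi>0 by (simp_all add: h_def)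
  have h\<phi>: "h * \<phi> = fps_X" using inverse_mult_eq_1[OF \<phi>0] by (simp add: h_def mult.assoc)
  have "(h oo g) * (\<phi> oo g) = fps_X * (\<phi> oo g)"
    using h\<phi> g g0 by (simp flip: fps_compose_mult_distrib)
  moreover have "\<phi> oo g \<noteq> 0" using \<phi>0 g0
    by (metis fps_compose_nth_0 fps_zero_nth)
  ultimately have "h oo g = fps_X" by simp
  then have gh: "g oo h = fps_X"
    using fps_compositional_inverse_unique g0 h by blast
  define P where "P = H oo g"
  have "P oo h = H"
    unfolding P_def by (subst fps_compose_assoc[symmetric]) (simp_all add: g0 h gh)
  then have "fps_deriv H = (fps_deriv P oo h) * fps_deriv h"
    using fps_compose_deriv[OF h(1), of P] by simp
  then have "(fps_deriv H * \<phi> ^ Suc n) $ n =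
      ((fps_deriv P oo h) * (fps_deriv h * \<phi> ^ Suc n)) $ n"
    by (simp add: mult.assoc)
  also have "\<dots> = (\<Sum>i=0..n. fps_deriv P $ i * (if i = n then 1 else 0))"
    unfolding fps_compose_mult_nth[OF h(1)]
    by (intro sum.cong refl)
      (simp add: Lagrange_coefficient[OF h(1) h\<phi>] del: power_Suc fps_deriv_nth)
  also have "\<dots> = of_nat (Suc n) * P $ Suc n" by (simp add: if_distrib cong: if_cong)
  finally show ?thesis by (simp add: P_def)
qed

section \<open>Coefficients of the powers of 1 + g\<close>

lemma fps_deriv_binomial:
  "fps_deriv (fps_binomial r) = fps_const r * fps_binomial (r - 1 :: 'k::field_char_0)"
  by (rule fps_ext) (use gbinomial_absorption[of _ r] in simp)

lemma one_plus_powr_mult: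
  "g $ 0 = 0 \<Longrightarrow> one_plus_powr g r * one_plus_powr g s = one_plus_powr g (r + s)"
  by (simp add: one_plus_powr_def fps_binomial_add_mult fps_compose_mult_distrib)

text \<open>Lagrange inversion with \<open>H = (1 + x)^r\<close>. The parameter \<open>y\<close> is
  free because both \<open>y = z\<close> (the series f) and \<open>y = -z\<close> (its reciprocal)
  are needed.\<close>

lemma one_plus_powr_nth:
  fixes a y :: "'k::field_char_0"
  assumes a1: "a + 1 \<noteq> 0" and g0: "g $ 0 = 0"
    and g: "g = fps_const (a + 1) * fps_X * one_plus_powr g (2 * a / (a + 1))"
  shows "one_plus_powr g (y * a / (a + 1)) $ Suc m =
    y * a / fact (Suc m) * (\<Prod>i=1..m. (2 * of_nat (Suc m) + y) * a - (a + 1) * of_nat i)"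
proof -
  let ?s = "2 * a / (a + 1)" and ?r = "y * a / (a + 1)"
  define \<phi> where "\<phi> = fps_const (a + 1) * fps_binomial ?s"
  \<comment> \<open>The total exponent: \<open>?r - 1\<close> from the derivative and
    \<open>Suc m\<close> times \<open>?s\<close> from \<open>\<phi> ^ Suc m\<close>.\<close>
  define c where "c = ?r - 1 + of_nat (Suc m) * ?s"
  have "g = fps_X * (\<phi> oo g)"
    by (subst (1) g) (simp add: \<phi>_def one_plus_powr_def fps_compose_mult_distrib g0 mult_ac)
  moreover have "\<phi> $ 0 \<noteq> 0" using a1 by (simp add: \<phi>_def)
  ultimately have L: "of_nat (Suc m) * one_plus_powr g ?r $ Suc m =
      (fps_deriv (fps_binomial ?r) * \<phi> ^ Suc m) $ m"
    unfolding one_plus_powr_def using g0 by (intro Lagrange_inversion)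
  have "fps_deriv (fps_binomial ?r) * \<phi> ^ Suc m =
      fps_const (?r * (a + 1) ^ Suc m) * fps_binomial c"
    unfolding \<phi>_def c_def fps_binomial_add_mult power_mult_distrib fps_binomial_power
      fps_deriv_binomial fps_const_power
    by (simp only: fps_const_mult[symmetric] mult_ac)
  then have "of_nat (Suc m) * one_plus_powr g ?r $ Suc m = ?r * (a + 1) ^ Suc m * (c gchoose m)"
    using L by simp
  also have "\<dots> = y * a * ((a + 1) ^ m * (c gchoose m))"
    using a1 by simp
  \<comment> \<open>One \<open>a + 1\<close> goes to each factor of the falling factorial and clears
    its denominator; the \<open>-1\<close> in \<open>c\<close> then shifts the range from 0..m-1 to
    1..m.\<close>
  also have "(a + 1) ^ m * (c gchoose m) = (\<Prod>i=0..<m. (a + 1) * (c - of_nat i)) / fact m"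
    by (simp add: gbinomial_prod_rev prod.distrib)
  also have "(\<Prod>i=0..<m. (a + 1) * (c - of_nat i)) =
      (\<Prod>i=1..m. (2 * of_nat (Suc m) + y) * a - (a + 1) * of_nat i)"
  proof -
    have "(a + 1) * c = (a + 1) * ?r - (a + 1) + of_nat (Suc m) * ((a + 1) * ?s)"
      by (simp only: c_def ring_distribs mult_1_right mult.left_commute)
    also have "\<dots> = (2 * of_nat (Suc m) + y) * a - (a + 1)"
    proof -
      have "(a + 1) * ?r = y * a" "(a + 1) * ?s = 2 * a"
        using a1 by simp_all
      then show ?thesis by (simp only: algebra_simps)
    qed
    finally have "(a + 1) * c = (2 * of_nat (Suc m) + y) * a - (a + 1)" .
    then have "(a + 1) * (c - of_nat i) =
        (2 * of_nat (Suc m) + y) * a - (a + 1) * of_nat (Suc i)" for i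
      by (simp add: algebra_simps)
    then show ?thesis
      by (simp only: prod.atLeast_Suc_atMost_Suc_shift[symmetric] One_nat_def
          atLeastLessThanSuc_atLeastAtMost[symmetric] prod.atLeast_Suc_lessThan_Suc_shift o_def)
  qed
  finally show ?thesis
    by (simp add: nonzero_eq_divide_eq mult_ac del: of_nat_Suc)
qed

section \<open>Recursive structure of plane forests\<close>

lemma PF_0: "PF 0 = {[]}"
proof -
  have [simp]: "tree_vertices t \<noteq> 0" for t by (cases t) simp
  then have "F = []" if "F \<in> PF 0" for F
    using that by (cases F) (auto simp: PF_def forest_vertices_def)
  then show ?thesis by (auto simp: PF_def forest_vertices_def)
qed

text \<open>Deleting the root of the first tree leaves \<open>n\<close> vertices, of which the
  \<open>k\<close> vertices of \<open>ts\<close> were below that root.\<close>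

lemma PF_Suc_bij:
  "bij_betw (\<lambda>(k, ts, F). Node ts # F) (SIGMA k:{..n}. PF k \<times> PF (n - k)) (PF (Suc n))"
  unfolding bij_betw_def
proof
  show "inj_on (\<lambda>(k, ts, F). Node ts # F) (SIGMA k:{..n}. PF k \<times> PF (n - k))"
    by (auto simp: inj_on_def PF_def)
  show "(\<lambda>(k, ts, F). Node ts # F) ` (SIGMA k:{..n}. PF k \<times> PF (n - k)) = PF (Suc n)"
  proof (intro equalityI subsetI)
    fix F assume F: "F \<in> PF (Suc n)"
    then obtain ts G where "F = Node ts # G"
      by (cases F; cases "hd F") (auto simp: PF_def forest_vertices_def)
    then show "F \<in> (\<lambda>(k, ts, F). Node ts # F) ` (SIGMA k:{..n}. PF k \<times> PF (n - k))"
      using F by (intro image_eqI[of _ _ "(forest_vertices ts, ts, G)"])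
        (auto simp: PF_def forest_vertices_def)
  qed (auto simp: PF_def forest_vertices_def)
qed

lemma hook_sum_Suc:
  fixes w :: "nat \<Rightarrow> 'k::comm_semiring_1"
  shows "(\<Sum>F\<in>PF (Suc n). \<Prod>h\<in>#hooks F. w h) =
    (\<Sum>k\<le>n. w (Suc k) * (\<Sum>F\<in>PF k. \<Prod>h\<in>#hooks F. w h) * (\<Sum>F\<in>PF (n - k). \<Prod>h\<in>#hooks F. w h))"
proof -
  define W where "W F = (\<Prod>h\<in>#hooks F. w h)" for F
  \<comment> \<open>Hook lengths inside \<open>ts\<close> and \<open>F\<close> are unchanged; the
    only new one, at the added root, is \<open>Suc k\<close>.\<close>
  have W: "W (Node ts # F) = w (Suc k) * W ts * W F" if "ts \<in> PF k" for k ts F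
    using that by (simp add: W_def hooks_def PF_def forest_vertices_def mult_ac)
  have "sum W (PF (Suc n)) =
      (\<Sum>(k, ts, F)\<in>(SIGMA k:{..n}. PF k \<times> PF (n - k)). W (Node ts # F))"
    by (subst sum.reindex_bij_betw[OF PF_Suc_bij, symmetric]) (simp add: case_prod_unfold)
  also have "\<dots> = (\<Sum>k\<le>n. \<Sum>ts\<in>PF k. \<Sum>F\<in>PF (n - k). W (Node ts # F))"
    by (simp add: sum.Sigma finite_PF sum.cartesian_product)
  also have "\<dots> = (\<Sum>k\<le>n. \<Sum>ts\<in>PF k. \<Sum>F\<in>PF (n - k). w (Suc k) * W ts * W F)"
    by (intro sum.cong refl W)
  also have "\<dots> = (\<Sum>k\<le>n. w (Suc k) * sum W (PF k) * sum W (PF (n - k)))"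
    by (simp add: sum_distrib_left[symmetric] sum_distrib_right[symmetric])
  finally show ?thesis unfolding W_def .
qed

text \<open>The coefficient of \<open>u * f = 1\<close> in degree \<open>Suc m\<close>, with
  \<open>w\<close> substituted for the coefficients of \<open>u\<close>, is the recurrence
  \<open>hook_sum_Suc\<close>, which determines the sums from the initial value 1.\<close>

lemma hook_sum_eqI:
  fixes f u :: "'k::comm_ring_1 fps"
  assumes f0: "f $ 0 = 1" and u0: "u $ 0 = 1" and inv: "u * f = 1"
    and w: "\<And>m. - u $ Suc m = w (Suc m) * f $ m"
  shows "(\<Sum>F\<in>PF n. \<Prod>h\<in>#hooks F. w h) = f $ n"
proof (induction n rule: less_induct)
  case (less n)
  show ?case
  proof (cases n)
    case 0
    then show ?thesis by (simp add: PF_0 hooks_def f0)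
  next
    case (Suc m)
    have "0 = (u * f) $ Suc m" by (simp add: inv)
    also have "\<dots> = f $ Suc m + (\<Sum>k\<le>m. u $ Suc k * f $ (m - k))"
      by (simp add: fps_mult_nth u0 atLeast0AtMost sum.atMost_Suc_shift del: sum.atMost_Suc)
    finally have "f $ Suc m = (\<Sum>k\<le>m. - u $ Suc k * f $ (m - k))"
      by (simp add: sum_negf eq_neg_iff_add_eq_0)
    also have "\<dots> = (\<Sum>F\<in>PF n. \<Prod>h\<in>#hooks F. w h)"
      unfolding Suc hook_sum_Suc w by (intro sum.cong refl) (simp add: less.IH Suc)
    finally show ?thesis by (simp add: Suc)
  qed
qed

section \<open>The weight as a quotient of coefficients\<close>

lemma prod_upto_int: "prod_upto c (int m) = (\<Prod>i=1..m. c (int i))"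
proof -
  have "{1..int m} = int ` {1..m}" by (simp add: image_int_atLeastAtMost)
  then show ?thesis by (simp add: prod_upto_def prod.reindex)
qed

text \<open>For positive \<open>m\<close>, the numerator of \<open>rho\<close> is the product in
  coefficient \<open>Suc m\<close> for \<open>-z\<close>, and its denominator contains the product
  in coefficient \<open>m\<close> for \<open>z\<close>, which cancels. The factorials account for
  \<open>1 / (m + 1)\<close>, the prefactors for the sign.\<close>

lemma rho_mult_nth:
  fixes a z :: "'k::field_char_0"
  assumes nz: "\<And>m i. (2 * of_nat m + z) * a - (a + 1) * of_nat i \<noteq> 0"
    and a1: "a + 1 \<noteq> 0" and g0: "g $ 0 = 0"
    and g: "g = fps_const (a + 1) * fps_X * one_plus_powr g (2 * a / (a + 1))"
  shows "rho a z (Suc m) * one_plus_powr g (z * a / (a + 1)) $ m =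
    - one_plus_powr g (- z * a / (a + 1)) $ Suc m"
proof (cases m)
  case 0
  \<comment> \<open>The upper limit \<open>-1\<close> occurs here: the convention puts
    \<open>1 / (z * a)\<close> in the denominator, in accordance with the constant coefficient
    1.\<close>
  have "rho a z (Suc 0) = z * a"
    by (simp add: rho_def prod_upto_def)
  then show ?thesis using one_plus_powr_nth[OF a1 g0 g, of "- z" 0]
    by (simp add: 0 one_plus_powr_def)
next
  case (Suc l)
  let ?N = "\<Prod>i=1..m. (2 * of_nat (Suc m) - z) * a - (a + 1) * of_nat i"
  let ?D = "\<Prod>i=1..l. (2 * of_nat m + z) * a - (a + 1) * of_nat i"
  have D: "?D \<noteq> 0" using nz by simp
  have "rho a z (Suc m) = ?N / (of_nat (Suc m) * ?D)"
  proof -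
    have "int (Suc m) - 1 = int m" "int (Suc m) - 2 = int l"
      "2 * of_nat (Suc m) - 2 = (2 * of_nat m :: 'k)"
      by (simp_all add: Suc)
    then show ?thesis by (simp only: rho_def prod_upto_int of_int_of_nat_eq)
  qed
  then show ?thesis
    using one_plus_powr_nth[OF a1 g0 g, of "- z" m] one_plus_powr_nth[OF a1 g0 g, of z l] D
    by (simp add: Suc)
qed

text \<open>Viewed as a polynomial in z, the expression has the coefficient a at z, whatever
  \<open>m\<close> and \<open>i\<close> are.\<close>

lemma linear_in_indet_z_nonzero:
  "(2 * of_nat m + indet_z) * indet_a - (indet_a + 1) * of_nat i \<noteq> 0"
proof -
  have of_nat: "of_nat k = to_fract (of_nat k :: rat poly poly)" for k
    by (induction k) (simp_all flip: to_fract_add to_fract_1)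
  define A Z :: "rat poly poly" where "A = [:[:0, 1:]:]" and "Z = [:0, 1:]"
  define p where "p = (of_nat (2 * m) + Z) * A - (A + 1) * of_nat i"
  \<comment> \<open>With 2 absorbed into \<open>of_nat\<close>, the fact \<open>of_nat\<close> can
    move every such constant into the polynomial ring, where coefficients can be read off.\<close>
  have "(2 * of_nat m + indet_z) * indet_a - (indet_a + 1) * of_nat i =
      (of_nat (2 * m) + indet_z) * indet_a - (indet_a + 1) * of_nat i"
    by simp
  also have "\<dots> = to_fract p"
    unfolding p_def A_def Z_def indet_a_def indet_z_def of_nat
    by (simp only: to_fract_add to_fract_1 to_fract_mult to_fract_diff)
  also have "\<dots> \<noteq> 0"
  proof -
    have "coeff p 1 = [:0, 1:]"
      by (simp add: p_def A_def Z_def of_nat_poly one_pCons)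
    then show ?thesis by auto
  qed
  finally show ?thesis .
qed

theorem theorem3p7:
  fixes a z :: ratfun and g f :: "ratfun fps"
  assumes a_eq: "a = indet_a" and z_eq: "z = indet_z"
    and g_0: "g $ 0 = 0"
    and g_eq: "g = fps_const (a + 1) * fps_X * one_plus_powr g (2 * a / (a + 1))"
    and f_eq: "f = one_plus_powr g (z * a / (a + 1))"
  shows "1 + Abs_fps (\<lambda>n. if n \<ge> 1 then \<Sum>F\<in>PF n. \<Prod>h\<in>#hooks F. rho a z h else 0) = f \<and>
         (\<forall>n\<ge>1. (\<Sum>F\<in>PF n. \<Prod>h\<in>#hooks F. rho a z h) =
           z * a / fact n *
           (\<Prod>i = 1..n - 1. (2 * of_nat n + z) * a - (a + 1) * of_nat i))"
proof -
  have a1: "a + 1 \<noteq> 0" by (simp add: a_eq indet_a_plus_1_nonzero)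
  have f0: "f $ 0 = 1" by (simp add: f_eq one_plus_powr_def)
  have S: "(\<Sum>F\<in>PF n. \<Prod>h\<in>#hooks F. rho a z h) = f $ n" for n
  proof (rule hook_sum_eqI)
    show "one_plus_powr g (- z * a / (a + 1)) $ 0 = 1"
      by (simp add: one_plus_powr_def)
    \<comment> \<open>The two exponents add up to 0.\<close>
    show "one_plus_powr g (- z * a / (a + 1)) * f = 1"
      by (simp add: f_eq one_plus_powr_mult g_0) (simp add: one_plus_powr_def)
    show "- one_plus_powr g (- z * a / (a + 1)) $ Suc m = rho a z (Suc m) * f $ m" for m
      unfolding f_eq
      by (rule rho_mult_nth[OF _ a1 g_0 g_eq, symmetric])
        (unfold a_eq z_eq, rule linear_in_indet_z_nonzero)
  qed (fact f0)
  have "1 + Abs_fps (\<lambda>n. if n \<ge> 1 then f $ n else 0) = f"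
    by (rule fps_ext) (simp add: f0 Suc_le_eq)
  moreover have "f $ n = z * a / fact n *
      (\<Prod>i = 1..n - 1. (2 * of_nat n + z) * a - (a + 1) * of_nat i)" if "n \<ge> 1" for n
    using that one_plus_powr_nth[OF a1 g_0 g_eq, of z "n - 1"] by (simp add: f_eq)
  ultimately show ?thesis unfolding S by blast
qed

end
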